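(* Let $F$ be a distribution function on $[0,\infty)$. If $F$ is Boolean-subexponential, then for every $n\geqslant 1$, $$\overline{F^{\uplus n}}(y)\sim\overline{F^{\vee_B n}}(y)\quad\text{as } y\to\infty .$$ Moreover, if $F$ is regularly varying with tail index $-\alpha$, $\alpha\geqslant 0$, then for all $n\geqslant 1$, $$\overline{F^{\vee_B n}}(y)\sim\overline{F^{\vee_F n}}(y)\sim\overline{F^{n}}(y)\quad\text{as } y\to\infty,$$ where $F^n(y)=F(y)^n$ is the classical max convolution power, i.e. the distribution function of $\max(Z_1,\dots,Z_n)$ for classically independent $Z_1,\dots,Z_n$ with common distribution $F$.
   Context: For a distribution function $F$ on $[0,\infty)$, $\overline F=1-F$; $F$ is regularly varying of tail index $-\alpha$ if $\overline F(tx)/\overline F(x)\to t^{-\alpha}$ as $x\to\infty$ for every $t>0$. $f\sim g$ means $f/g\to1$. Additive Boolean convolution: for a probability measure $\mu$ on $\mathbb{R}$, $G_\mu(z)=\int\frac{1}{z-t}d\mu(t)$, $K_\mu(z)=z-1/G_\mu(z)$ for $z\in\mathbb{C}^+$, and $\mu\uplus\nu$ is the unique probability measure with $K_{\mu\uplus\nu}=K_\mu+K_\nu$ on $\mathbb{C}^+$. $F^{\uplus n}$ denotes the distribution function of the $n$-fold Boolean convolution $\mu\uplus\cdots\uplus\mu$ where $\mu$ has distribution function $F$. $F$ is Boolean-subexponential if $\overline F(y)>0$ for all $y\geqslant0$ and $\overline{F^{\uplus n}}(y)\sim n\overline F(y)$ as $y\to\infty$ for all $n\in\mathbb{N}$.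 Boolean max convolution: for distribution functions $F_1,F_2$ on $[0,\infty)$, $(F_1\vee_B F_2)(t)=F_1(t)\wedge_B F_2(t)$, where for $x,y\in[0,1]$ the number $x\wedge_B y\in[0,1]$ is defined by $(x\wedge_B y)^{-1}-1=(x^{-1}-1)+(y^{-1}-1)$ (with $0^{-1}=\infty$). $F^{\vee_B n}=F\vee_B\cdots\vee_B F$ ($n$ times). Free max convolution: $(F_1\vee_F F_2)(t)=\max(F_1(t)+F_2(t)-1,0)$, and $F^{\vee_F n}=F\vee_F\cdots\vee_F F$ ($n$ times). *)

theory Defs
  imports "HOL-Probability.Probability" "HOL-Library.Landau_Symbols"
begin

section \<open>Distribution functions on the half-line\<close>

text \<open>A distribution function on \<open>[0,\<infinity>)\<close> is a function on the whole real line that vanishes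
  on the negative half-line.  An atom at \<open>0\<close> is allowed.\<close>

definition distribution_function_nonneg :: "(real \<Rightarrow> real) \<Rightarrow> bool" where
  "distribution_function_nonneg F \<longleftrightarrow>
     mono F \<and> (\<forall>a. continuous (at_right a) F) \<and> (F \<longlongrightarrow> 1) at_top \<and> (\<forall>x<0. F x = 0)"

definition tail :: "(real \<Rightarrow> real) \<Rightarrow> real \<Rightarrow> real" where
  "tail F = (\<lambda>x. 1 - F x)"

text \<open>Since \<open>t powr (-\<alpha>) > 0\<close> and \<open>x / 0 = 0\<close>, the limit forces the tail to be eventually
  nonzero.\<close>

definition regularly_varying_tail :: "(real \<Rightarrow> real) \<Rightarrow> real \<Rightarrow> bool" where
  "regularly_varying_tail F \<alpha> \<longleftrightarrow>
     (\<forall>t>0. ((\<lambda>x. tail F (t * x) / tail F x) \<longlongrightarrow> t powr (- \<alpha>)) at_top)"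

text \<open>The \<open>n\<close>-fold product \<open>x \<star> (x \<star> (\<dots> \<star> x))\<close> with \<open>n\<close> factors, meaningful for \<open>n \<ge> 1\<close>.\<close>

definition nfold :: "('a \<Rightarrow> 'a \<Rightarrow> 'a) \<Rightarrow> 'a \<Rightarrow> nat \<Rightarrow> 'a" where
  "nfold star x n = (star x ^^ (n - 1)) x"

section \<open>Additive Boolean convolution\<close>

definition cauchy_transform :: "real measure \<Rightarrow> complex \<Rightarrow> complex" where
  "cauchy_transform \<mu> z = (LINT t|\<mu>. 1 / (z - complex_of_real t))"

definition K_transform :: "real measure \<Rightarrow> complex \<Rightarrow> complex" where
  "K_transform \<mu> z = z - 1 / cauchy_transform \<mu> z"

text \<open>For Borel probability measures \<open>\<mu>\<close> and \<open>\<nu>\<close>, exactly one measure satisfies the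
  description (Speicher and Woroudi); for other arguments the value is unspecified.\<close>

definition boolean_conv :: "real measure \<Rightarrow> real measure \<Rightarrow> real measure" where
  "boolean_conv \<mu> \<nu> = (THE \<rho>. real_distribution \<rho> \<and>
     (\<forall>z. Im z > 0 \<longrightarrow> K_transform \<rho> z = K_transform \<mu> z + K_transform \<nu> z))"

definition boolean_conv_power :: "(real \<Rightarrow> real) \<Rightarrow> nat \<Rightarrow> real \<Rightarrow> real" where
  "boolean_conv_power F n = cdf (nfold boolean_conv (interval_measure F) n)"

definition boolean_subexponential :: "(real \<Rightarrow> real) \<Rightarrow> bool" where
  "boolean_subexponential F \<longleftrightarrow>
     (\<forall>y\<ge>0. tail F y > 0) \<and>
     (\<forall>n\<ge>1. tail (boolean_conv_power F n) \<sim>[at_top] (\<lambda>y. real n * tail F y))"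

section \<open>Boolean and free max convolution\<close>

text \<open>The defining equation is read in the extended reals, where \<open>inverse 0 = \<infinity>\<close>.\<close>

definition boolean_min :: "real \<Rightarrow> real \<Rightarrow> real" where
  "boolean_min x y = (THE w. w \<in> {0..1} \<and>
     inverse (ereal w) - 1 = (inverse (ereal x) - 1) + (inverse (ereal y) - 1))"

lemma boolean_min_eq:
  assumes "x \<in> {0..1}" "y \<in> {0..1}"
  shows "boolean_min x y = (if x = 0 \<or> y = 0 then 0 else 1 / (1 / x + 1 / y - 1))"
proof (cases "x = 0 \<or> y = 0")
  case True
  have "inverse (ereal x) \<noteq> -\<infinity>" "inverse (ereal y) \<noteq> -\<infinity>"
    using assms by auto
  with True have *: "(inverse (ereal x) - 1) + (inverse (ereal y) - 1) = \<infinity>"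
    by (cases "x = 0"; cases "y = 0") (auto simp: one_ereal_def)
  have "boolean_min x y = 0"
    unfolding boolean_min_def * 
    by (rule the_equality) (auto simp: one_ereal_def split: if_splits)
  with True show ?thesis by simp
next
  case False
  with assms have pos: "0 < x" "x \<le> 1" "0 < y" "y \<le> 1" by auto
  define d where "d = 1 / x + 1 / y - 1"
  have "1 / x \<ge> 1" "1 / y \<ge> 1" using pos by auto
  then have d: "d \<ge> 1" by (simp add: d_def)
  have *: "(inverse (ereal x) - 1) + (inverse (ereal y) - 1) = ereal (d - 1)"
    using pos by (simp add: one_ereal_def d_def inverse_eq_divide)
  have "boolean_min x y = 1 / d"
    unfolding boolean_min_def *
  proof (rule the_equality)
    show "1 / d \<in> {0..1} \<and> inverse (ereal (1 / d)) - 1 = ereal (d - 1)"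
      using d by (auto simp: one_ereal_def)
  next
    fix w assume "w \<in> {0..1} \<and> inverse (ereal w) - 1 = ereal (d - 1)"
    then show "w = 1 / d"
      using d by (cases "w = 0") (auto simp: one_ereal_def field_simps)
  qed
  with False show ?thesis by (simp add: d_def)
qed

definition boolean_max_conv :: "(real \<Rightarrow> real) \<Rightarrow> (real \<Rightarrow> real) \<Rightarrow> real \<Rightarrow> real" where
  "boolean_max_conv F G = (\<lambda>t. boolean_min (F t) (G t))"

definition free_max_conv :: "(real \<Rightarrow> real) \<Rightarrow> (real \<Rightarrow> real) \<Rightarrow> real \<Rightarrow> real" where
  "free_max_conv F G = (\<lambda>t. max (F t + G t - 1) 0)"

end

theory Submission
  imports Defs
begin

text \<open>All three max convolutions act pointwise: the value at \<open>y\<close> of the \<open>n\<close>-fold power is a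
  function \<open>\<phi>\<close> of \<open>u = F y\<close> alone, with \<open>\<phi> u = u / (u + n (1 - u))\<close> in the Boolean case,
  \<open>\<phi> u = max (1 - n (1 - u)) 0\<close> in the free case and \<open>\<phi> u = u ^ n\<close> in the classical case. Each
  of these functions satisfies \<open>\<phi> 1 = 1\<close> and has derivative \<open>n\<close> at \<open>1\<close>. As \<open>F y\<close> tends to \<open>1\<close>,
  the tail of each power is therefore asymptotic to \<open>n\<close> times the tail of \<open>F\<close> (lemma
  \<open>tail_asymp_equiv_of_factor\<close>), so the three are asymptotic to each other. For a
  Boolean-subexponential \<open>F\<close> the tail of the additive power has this same asymptotic behaviour
  by definition, which gives its comparison with the Boolean max power.\<close>

lemma distribution_function_nonneg_range:
  assumes "distribution_function_nonneg F"
  shows "F y \<in> {0..1}"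
proof -
  have mono: "mono F" and lim: "(F \<longlongrightarrow> 1) at_top" and neg: "\<And>x. x < 0 \<Longrightarrow> F x = 0"
    using assms by (auto simp: distribution_function_nonneg_def)
  have "F (min y (-1)) \<le> F y" by (intro monoD[OF mono]) simp
  then have "0 \<le> F y" using neg[of "min y (-1)"] by simp
  moreover have "F y \<le> 1"
    by (rule tendsto_lowerbound[OF lim])
       (auto intro!: eventually_mono[OF eventually_ge_at_top[of y]] monoD[OF mono])
  ultimately show ?thesis by simp
qed

text \<open>The factor \<open>c\<close> is the slope of \<open>\<phi>\<close> between \<open>u\<close> and \<open>1\<close>. Working with the product rather
  than with the quotient of the tails also covers an \<open>F\<close> whose tail vanishes eventually.\<close>

lemma tail_asymp_equiv_of_factor:
  assumes lim: "(F \<longlongrightarrow> 1) at_top" and cont: "isCont c 1" and nz: "c 1 \<noteq> 0"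
    and eq: "eventually (\<lambda>y. tail G y = c (F y) * tail F y) at_top"
  shows "tail G \<sim>[at_top] (\<lambda>y. c 1 * tail F y)"
proof -
  have "((\<lambda>y. c (F y)) \<longlongrightarrow> c 1) at_top"
    by (rule isCont_tendsto_compose[OF cont lim])
  then have "(\<lambda>y. c (F y)) \<sim>[at_top] (\<lambda>_. c 1)"
    using nz by (rule tendsto_imp_asymp_equiv_const)
  then have "(\<lambda>y. c (F y) * tail F y) \<sim>[at_top] (\<lambda>y. c 1 * tail F y)"
    by (intro asymp_equiv_mult asymp_equiv_refl)
  then show ?thesis
    by (rule asymp_equiv_trans[OF asymp_equiv_refl_ev[OF eq]])
qed

lemma nfold_Suc:
  assumes "n \<ge> 1"
  shows "nfold star x (Suc n) = star x (nfold star x n)"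
  using assms by (cases n) (simp_all add: nfold_def)

text \<open>The map \<open>w \<mapsto> 1 / w - 1\<close> turns \<open>boolean_min\<close> into addition, so the power \<open>w\<close> of \<open>u = F y\<close>
  satisfies \<open>1 / w - 1 = n (1 / u - 1)\<close>. Cleared of inner fractions, the solution is also
  correct for \<open>u = 0\<close>.\<close>

lemma nfold_boolean_max_conv:
  assumes "F y \<in> {0..1}" and "n \<ge> 1"
  shows "nfold boolean_max_conv F n y = F y / (F y + real n * (1 - F y))"
  using assms(2)
proof (induction n rule: dec_induct)
  case base
  then show ?case by (simp add: nfold_def)
next
  case (step n)
  define u w where "u = F y" and "w = u / (u + real n * (1 - u))"
  have u: "0 \<le> u" "u \<le> 1" using assms(1) by (auto simp: u_def)
  have w_eq: "nfold boolean_max_conv F n y = w"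
    using step.IH by (simp add: u_def w_def)
  have eq: "nfold boolean_max_conv F (Suc n) y = boolean_min u w"
    unfolding nfold_Suc[OF step.hyps(1)]
    by (simp add: boolean_max_conv_def[of F] w_eq u_def)
  show ?case
  proof (cases "u = 0")
    case True
    then show ?thesis
      unfolding eq by (subst boolean_min_eq) (simp_all add: w_def u_def[symmetric])
  next
    case False
    with u have pos: "0 < u" by simp
    have nn: "0 \<le> real n * (1 - u)" using u by simp
    have den: "u + real n * (1 - u) > 0" using pos nn by linarith
    have w: "w \<in> {0..1}" "w \<noteq> 0"
      using pos nn den by (auto simp: w_def)
    have "1 / u + 1 / w - 1 = (u + real (Suc n) * (1 - u)) / u"
      using pos den by (simp add: w_def field_simps)
    then show ?thesis
      unfolding eq using u w False by (subst boolean_min_eq) (auto simp: u_def[symmetric])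
  qed
qed

lemma nfold_free_max_conv:
  assumes "F y \<in> {0..1}" and "n \<ge> 1"
  shows "nfold free_max_conv F n y = max (1 - real n * (1 - F y)) 0"
  using assms(2)
proof (induction n rule: dec_induct)
  case base
  then show ?case using assms by (simp add: nfold_def)
next
  case (step n)
  then show ?case
    using assms(1) by (auto simp: nfold_Suc free_max_conv_def max_def algebra_simps)
qed

lemma tail_nfold_boolean_max_conv_asymp_equiv:
  assumes "distribution_function_nonneg F" and "n \<ge> 1"
  shows "tail (nfold boolean_max_conv F n) \<sim>[at_top] (\<lambda>y. real n * tail F y)"
proof -
  define c where "c u = real n / (u + real n * (1 - u))" for u :: real
  have lim: "(F \<longlongrightarrow> 1) at_top"
    using assms(1) by (simp add: distribution_function_nonneg_def)
  have "tail (nfold boolean_max_conv F n) y = c (F y) * tail F y" for y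
  proof -
    have F: "F y \<in> {0..1}" by (rule distribution_function_nonneg_range[OF assms(1)])
    have "F y + real n * (1 - F y) > 0"
      using F assms(2) by (cases "F y = 0") (auto intro: add_pos_nonneg)
    then show ?thesis
      unfolding tail_def c_def nfold_boolean_max_conv[of F y, OF F assms(2)]
      by (simp add: field_simps)
  qed
  moreover have "isCont c 1" unfolding c_def by (intro continuous_intros) simp
  ultimately show ?thesis
    using tail_asymp_equiv_of_factor[OF lim, of c "nfold boolean_max_conv F n"] assms(2)
    by (simp add: c_def)
qed

lemma tail_nfold_free_max_conv_asymp_equiv:
  assumes "distribution_function_nonneg F" and "n \<ge> 1"
  shows "tail (nfold free_max_conv F n) \<sim>[at_top] (\<lambda>y. real n * tail F y)"
proof -
  have lim: "(F \<longlongrightarrow> 1) at_top"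
    using assms(1) by (simp add: distribution_function_nonneg_def)
  \<comment> \<open>Once \<open>F y > 1 - 1 / n\<close>, the truncation at \<open>0\<close> is inactive.\<close>
  have "eventually (\<lambda>y. F y > 1 - 1 / real n) at_top"
    using assms(2) by (intro order_tendstoD(1)[OF lim]) simp
  then have "eventually (\<lambda>y. tail (nfold free_max_conv F n) y = real n * tail F y) at_top"
  proof eventually_elim
    case (elim y)
    have "F y \<in> {0..1}" by (rule distribution_function_nonneg_range[OF assms(1)])
    moreover have "real n * (1 - F y) < 1"
      using elim assms(2) by (simp add: field_simps)
    ultimately show ?case
      using assms(2) by (simp add: tail_def nfold_free_max_conv)
  qed
  then show ?thesis by (rule asymp_equiv_refl_ev)
qed

lemma tail_power_asymp_equiv:
  assumes "distribution_function_nonneg F" and "n \<ge> 1"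
  shows "tail (\<lambda>y. F y ^ n) \<sim>[at_top] (\<lambda>y. real n * tail F y)"
proof -
  define c where "c u = (\<Sum>i<n. u ^ i)" for u :: real
  have lim: "(F \<longlongrightarrow> 1) at_top"
    using assms(1) by (simp add: distribution_function_nonneg_def)
  have "tail (\<lambda>y. F y ^ n) y = c (F y) * tail F y" for y
    by (simp add: tail_def c_def one_diff_power_eq mult.commute)
  moreover have "isCont c 1" unfolding c_def by (intro continuous_intros)
  ultimately show ?thesis
    using tail_asymp_equiv_of_factor[OF lim, of c "\<lambda>y. F y ^ n"] assms(2)
    by (simp add: c_def)
qed

theorem proposition2p1:
  fixes F :: "real \<Rightarrow> real"
  assumes "distribution_function_nonneg F"
  shows "(boolean_subexponential F \<longrightarrow>
            (\<forall>n\<ge>1. tail (boolean_conv_power F n) \<sim>[at_top] tail (nfold boolean_max_conv F n)))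
       \<and> (\<forall>\<alpha>\<ge>0. regularly_varying_tail F \<alpha> \<longrightarrow>
            (\<forall>n\<ge>1. tail (nfold boolean_max_conv F n) \<sim>[at_top] tail (nfold free_max_conv F n)
                 \<and> tail (nfold free_max_conv F n) \<sim>[at_top] tail (\<lambda>y. F y ^ n)))"
proof (intro conjI impI allI)
  fix n :: nat assume "boolean_subexponential F" and n: "n \<ge> 1"
  then have "tail (boolean_conv_power F n) \<sim>[at_top] (\<lambda>y. real n * tail F y)"
    by (simp add: boolean_subexponential_def)
  then show "tail (boolean_conv_power F n) \<sim>[at_top] tail (nfold boolean_max_conv F n)"
    using tail_nfold_boolean_max_conv_asymp_equiv[OF assms n]
    by (rule asymp_equiv_trans[OF _ asymp_equiv_symI])
next
  fix n :: nat assume n: "n \<ge> 1"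
  note equivs = tail_nfold_boolean_max_conv_asymp_equiv[OF assms n]
    tail_nfold_free_max_conv_asymp_equiv[OF assms n] tail_power_asymp_equiv[OF assms n]
  show "tail (nfold boolean_max_conv F n) \<sim>[at_top] tail (nfold free_max_conv F n)"
    by (rule asymp_equiv_trans[OF equivs(1) asymp_equiv_symI[OF equivs(2)]])
  show "tail (nfold free_max_conv F n) \<sim>[at_top] tail (\<lambda>y. F y ^ n)"
    by (rule asymp_equiv_trans[OF equivs(2) asymp_equiv_symI[OF equivs(3)]])
qed

end
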